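(* Let $G=(V,E)$ be a connected graph with $V=\{1,\dots,N\}$, $E\subset\{(n,m)\in V\times V: n<m\}$, $M=|E|$, let $w\in\mathbb{R}^N$ and $\lambda\in\mathbb{R}^M$ have positive entries, and let $y=(y_n)_{n\in V}\in\mathbb{H}^N$ be unit quaternions, $|y_n|=1$ for all $n$. Consider the two convex problems $$\text{(A)}\quad \operatorname*{arg\,min}_{x\in\mathbb{H}^N,\ r\in\mathbb{H}^M}\ \mathcal J(x,r)\quad\text{s.t.}\quad P_{(n,m)}\succeq 0\ \text{ for all }(n,m)\in E,$$ $$\text{(B)}\quad \operatorname*{arg\,min}_{\boldsymbol x\in(\mathbb{R}^4)^N,\ \boldsymbol \ell\in\mathbb{R}^M}\ \mathcal K(\boldsymbol x,\boldsymbol \ell)\quad\text{s.t.}\quad \boldsymbol Q_{(n,m)}\succeq 0\ \text{ for all }(n,m)\in E,$$ where $\mathcal J,\mathcal K,P_{(n,m)},\boldsymbol Q_{(n,m)}$ and the identification $z\leftrightarrow\boldsymbol z$ of $\mathbb{H}$ with $\mathbb{R}^4$ are as defined in the context. These problems are equivalent in the following sense: (i) If $(\hat x,\hat r)$ solves (A), then $(\hat{\boldsymbol x},\operatorname{Re}[\hat r])$ solves (B), where $\hat{\boldsymbol x}_n\in\mathbb{R}^4$ is the vector identified with $\hat x_n$ and $\operatorname{Re}$ is taken componentwise. (ii) If $(\tilde{\boldsymbol x},\tilde{\boldsymbol\ell})$ solves (B), then $(\tilde x,\tilde r)$ solves (A), where $\tilde x_n\in\mathbb{H}$ is the quaternion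 identified with $\tilde{\boldsymbol x}_n$ and $\tilde r_{(n,m)}=\tilde{\boldsymbol\ell}_{(n,m)}+\operatorname{Im}[\overline{\tilde x}_m\tilde x_n]$ for all $(n,m)\in E$.
   Context: "Solves" means "is a minimizer of". $\mathbb{H}$ denotes the quaternions $z=z_1+\mathrm i z_2+\mathrm j z_3+\mathrm k z_4$, $z_i\in\mathbb{R}$, with $\mathrm i^2=\mathrm j^2=\mathrm k^2=-1$, $\mathrm{ij}=-\mathrm{ji}=\mathrm k$, $\mathrm{jk}=-\mathrm{kj}=\mathrm i$, $\mathrm{ki}=-\mathrm{ik}=\mathrm j$; $\bar z=z_1-\mathrm i z_2-\mathrm j z_3-\mathrm k z_4$, $|z|^2=\bar zz$, $\operatorname{Re}[z]=z_1$, and $\operatorname{Im}[z]=\mathrm i z_2+\mathrm j z_3+\mathrm k z_4$ (a quaternion). The quaternion $z$ is identified with $\boldsymbol z=(z_1,z_2,z_3,z_4)^{\mathrm T}\in\mathbb{R}^4$. For quaternion matrices, $A^{\mathrm H}$ is the conjugate transpose; a Hermitian matrix $A=A^{\mathrm H}\in\mathbb{H}^{d\times d}$ is positive semi-definite, $A\succeq0$, if $z^{\mathrm H}Az\ge0$ for all $z\in\mathbb{H}^d$. For real matrices, $\succeq 0$ means symmetric positive semi-definite. $\boldsymbol I_4$ is the $4\times4$ identity and $\langle\cdot,\cdot\rangle$ the Euclidean inner product. The objectives are $$\mathcal J(x,r)=-\sum_{n\in V}w_n\operatorname{Re}[x_n\bar y_n]-\sum_{(n,m)\in E}\lambda_{(n,m)}\operatorname{Re}[r_{(n,m)}],$$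 $$\mathcal K(\boldsymbol x,\boldsymbol\ell)=-\sum_{n\in V}w_n\langle\boldsymbol x_n,\boldsymbol y_n\rangle-\sum_{(n,m)\in E}\lambda_{(n,m)}\boldsymbol\ell_{(n,m)},$$ and the matrices are $$P_{(n,m)}=\begin{bmatrix}1&x_n&x_m\\ \bar x_n&1&\bar r_{(n,m)}\\ \bar x_m&r_{(n,m)}&1\end{bmatrix}\in\mathbb{H}^{3\times3},\qquad \boldsymbol Q_{(n,m)}=\begin{bmatrix}\boldsymbol I_4&\boldsymbol x_n&\boldsymbol x_m\\ \boldsymbol x_n^{\mathrm T}&1&\boldsymbol\ell_{(n,m)}\\ \boldsymbol x_m^{\mathrm T}&\boldsymbol\ell_{(n,m)}&1\end{bmatrix}\in\mathbb{R}^{6\times6}.$$ *)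

theory Defs
  imports "HOL-Analysis.Analysis"
begin

codatatype quat = Quat (qRe: real) (qI: real) (qJ: real) (qK: real)

lemma quat_eq_iff:
  "x = y \<longleftrightarrow> qRe x = qRe y \<and> qI x = qI y \<and> qJ x = qJ y \<and> qK x = qK y"
  by (auto intro: quat.expand)

instantiation quat :: ring_1
begin

primcorec zero_quat where
  "qRe 0 = 0" | "qI 0 = 0" | "qJ 0 = 0" | "qK 0 = 0"

primcorec one_quat where
  "qRe 1 = 1" | "qI 1 = 0" | "qJ 1 = 0" | "qK 1 = 0"

primcorec plus_quat where
  "qRe (x + y) = qRe x + qRe y"
| "qI (x + y) = qI x + qI y"
| "qJ (x + y) = qJ x + qJ y"
| "qK (x + y) = qK x + qK y"

primcorec uminus_quat where
  "qRe (- x) = - qRe x"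
| "qI (- x) = - qI x"
| "qJ (- x) = - qJ x"
| "qK (- x) = - qK x"

primcorec minus_quat where
  "qRe (x - y) = qRe x - qRe y"
| "qI (x - y) = qI x - qI y"
| "qJ (x - y) = qJ x - qJ y"
| "qK (x - y) = qK x - qK y"

primcorec times_quat where
  "qRe (x * y) = qRe x * qRe y - qI x * qI y - qJ x * qJ y - qK x * qK y"
| "qI (x * y) = qRe x * qI y + qI x * qRe y + qJ x * qK y - qK x * qJ y"
| "qJ (x * y) = qRe x * qJ y - qI x * qK y + qJ x * qRe y + qK x * qI y"
| "qK (x * y) = qRe x * qK y + qI x * qJ y - qJ x * qI y + qK x * qRe y"

instance
  by standard (simp_all add: quat_eq_iff algebra_simps)

end

instantiation quat :: real_algebra_1
begin

primcorec scaleR_quat where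
  "qRe (scaleR c x) = c * qRe x"
| "qI (scaleR c x) = c * qI x"
| "qJ (scaleR c x) = c * qJ x"
| "qK (scaleR c x) = c * qK x"

instance
  by standard (simp_all add: quat_eq_iff algebra_simps)

end

instantiation quat :: real_inner
begin

definition inner_quat :: "quat \<Rightarrow> quat \<Rightarrow> real" where
  "inner_quat x y = qRe x * qRe y + qI x * qI y + qJ x * qJ y + qK x * qK y"

definition norm_quat :: "quat \<Rightarrow> real" where
  "norm_quat x = sqrt (inner x x)"

definition sgn_quat :: "quat \<Rightarrow> quat" where
  "sgn_quat x = x /\<^sub>R norm x"

definition dist_quat :: "quat \<Rightarrow> quat \<Rightarrow> real" where
  "dist_quat x y = norm (x - y)"

definition uniformity_quat :: "(quat \<times> quat) filter" where
  "uniformity_quat = (INF e\<in>{0 <..}. principal {(x, y). dist x y < e})"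

definition open_quat :: "quat set \<Rightarrow> bool" where
  "open_quat U \<longleftrightarrow> (\<forall>x\<in>U. eventually (\<lambda>(x', y). x' = x \<longrightarrow> y \<in> U) uniformity)"

instance
proof
  fix x y z :: quat and r :: real
  show "inner x y = inner y x"
    by (simp add: inner_quat_def mult.commute)
  show "inner (x + y) z = inner x z + inner y z"
    by (simp add: inner_quat_def algebra_simps)
  show "inner (scaleR r x) y = r * inner x y"
    by (simp add: inner_quat_def algebra_simps)
  show "0 \<le> inner x x"
    by (simp add: inner_quat_def)
  show "inner x x = 0 \<longleftrightarrow> x = 0"
    by (auto simp: inner_quat_def quat_eq_iff add_nonneg_eq_0_iff)
  show "norm x = sqrt (inner x x)"
    by (rule norm_quat_def)
qed (rule sgn_quat_def dist_quat_def uniformity_quat_def open_quat_def)+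

end

lemma qRe_of_real [simp]: "qRe (of_real c) = c"
  and qI_of_real [simp]: "qI (of_real c) = 0"
  and qJ_of_real [simp]: "qJ (of_real c) = 0"
  and qK_of_real [simp]: "qK (of_real c) = 0"
  by (simp_all add: of_real_def)

lemma quat_units:
  defines "i \<equiv> Quat 0 1 0 0" and "j \<equiv> Quat 0 0 1 0" and "k \<equiv> Quat 0 0 0 1"
  shows "i * i = - 1" "j * j = - 1" "k * k = - 1"
    and "i * j = k" "j * i = - k" "j * k = i" "k * j = - i" "k * i = j" "i * k = - j"
    and "Quat a b c d = of_real a + i * of_real b + j * of_real c + k * of_real d"
  by (simp_all add: quat_eq_iff i_def j_def k_def)

primcorec qcnj :: "quat \<Rightarrow> quat" where
  "qRe (qcnj z) = qRe z"
| "qI (qcnj z) = - qI z"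
| "qJ (qcnj z) = - qJ z"
| "qK (qcnj z) = - qK z"

lemma qcnj_mult_self: "qcnj z * z = of_real ((norm z)\<^sup>2)"
  unfolding power2_norm_eq_inner by (simp add: quat_eq_iff inner_quat_def)

definition qIm :: "quat \<Rightarrow> quat" where
  "qIm z = Quat 0 (qI z) (qJ z) (qK z)"

definition vec_of_quat :: "quat \<Rightarrow> real^4" where
  "vec_of_quat z = vector [qRe z, qI z, qJ z, qK z]"

definition quat_of_vec :: "real^4 \<Rightarrow> quat" where
  "quat_of_vec v = Quat (v $ 1) (v $ 2) (v $ 3) (v $ 4)"

lemma vector_4 [simp]:
  "(vector [a, b, c, d] :: 'a::zero^4) $ 1 = a"
  "(vector [a, b, c, d] :: 'a::zero^4) $ 2 = b"
  "(vector [a, b, c, d] :: 'a::zero^4) $ 3 = c"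
  "(vector [a, b, c, d] :: 'a::zero^4) $ 4 = d"
  by (simp_all add: vector_def)

lemma quat_of_vec_of_quat [simp]: "quat_of_vec (vec_of_quat z) = z"
  by (simp add: quat_of_vec_def vec_of_quat_def)

lemma vec_of_quat_of_vec [simp]: "vec_of_quat (quat_of_vec v) = v"
  by (simp add: quat_of_vec_def vec_of_quat_def vec_eq_iff forall_4)

definition hermitian_transpose :: "quat^'n^'m \<Rightarrow> quat^'m^'n" where
  "hermitian_transpose A = (\<chi> i j. qcnj (A $ j $ i))"

text \<open>The sum below is the quaternion \<open>z\<^sup>H A z\<close>; membership in \<open>\<real>\<^sub>\<ge>\<^sub>0\<close> says that
  it is real and nonnegative.\<close>

definition qpsd :: "quat^'n^'n \<Rightarrow> bool" where
  "qpsd A \<longleftrightarrow> hermitian_transpose A = A \<and>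
     (\<forall>z. (\<Sum>i\<in>UNIV. qcnj (z $ i) * (A *v z) $ i) \<in> \<real>\<^sub>\<ge>\<^sub>0)"

definition psd :: "real^'n^'n \<Rightarrow> bool" where
  "psd A \<longleftrightarrow> transpose A = A \<and> (\<forall>z. 0 \<le> z \<bullet> (A *v z))"

text \<open>The edge set \<open>E\<close> lists each undirected edge once; being connected refers to
  paths that may traverse edges in both directions.\<close>

definition connected_graph :: "'a set \<Rightarrow> ('a \<times> 'a) set \<Rightarrow> bool" where
  "connected_graph V E \<longleftrightarrow>
     V \<noteq> {} \<and> E \<subseteq> V \<times> V \<and> (\<forall>u\<in>V. \<forall>v\<in>V. (u, v) \<in> (E \<union> E\<inverse>)\<^sup>*)"

definition J_obj :: "nat set \<Rightarrow> (nat \<times> nat) set \<Rightarrow> (nat \<Rightarrow> real) \<Rightarrow> (nat \<times> nat \<Rightarrow> real) \<Rightarrow>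
    (nat \<Rightarrow> quat) \<Rightarrow> (nat \<Rightarrow> quat) \<Rightarrow> (nat \<times> nat \<Rightarrow> quat) \<Rightarrow> real" where
  "J_obj V E w lam y x r =
     - (\<Sum>n\<in>V. w n * qRe (x n * qcnj (y n))) - (\<Sum>e\<in>E. lam e * qRe (r e))"

definition K_obj :: "nat set \<Rightarrow> (nat \<times> nat) set \<Rightarrow> (nat \<Rightarrow> real) \<Rightarrow> (nat \<times> nat \<Rightarrow> real) \<Rightarrow>
    (nat \<Rightarrow> real^4) \<Rightarrow> (nat \<Rightarrow> real^4) \<Rightarrow> (nat \<times> nat \<Rightarrow> real) \<Rightarrow> real" where
  "K_obj V E w lam y x l =
     - (\<Sum>n\<in>V. w n * (x n \<bullet> y n)) - (\<Sum>e\<in>E. lam e * l e)"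

definition P_mat :: "quat \<Rightarrow> quat \<Rightarrow> quat \<Rightarrow> quat^3^3" where
  "P_mat xn xm r = vector
    [vector [1,       xn, xm],
     vector [qcnj xn, 1,  qcnj r],
     vector [qcnj xm, r,  1]]"

definition Q_mat :: "real^4 \<Rightarrow> real^4 \<Rightarrow> real \<Rightarrow> real^6^6" where
  "Q_mat xn xm l = vector
    [vector [1,      0,      0,      0,      xn $ 1, xm $ 1],
     vector [0,      1,      0,      0,      xn $ 2, xm $ 2],
     vector [0,      0,      1,      0,      xn $ 3, xm $ 3],
     vector [0,      0,      0,      1,      xn $ 4, xm $ 4],
     vector [xn $ 1, xn $ 2, xn $ 3, xn $ 4, 1,      l],
     vector [xm $ 1, xm $ 2, xm $ 3, xm $ 4, l,      1]]"

text \<open>Families indexed by \<open>V\<close> and \<open>E\<close> are extensional functions, so that the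
  decision variables range exactly over \<open>\<H>\<^sup>N \<times> \<H>\<^sup>M\<close> and \<open>(\<real>\<^sup>4)\<^sup>N \<times> \<real>\<^sup>M\<close>.\<close>

definition feasible_A :: "nat set \<Rightarrow> (nat \<times> nat) set \<Rightarrow>
    (nat \<Rightarrow> quat) \<times> (nat \<times> nat \<Rightarrow> quat) \<Rightarrow> bool" where
  "feasible_A V E = (\<lambda>(x, r). x \<in> V \<rightarrow>\<^sub>E UNIV \<and> r \<in> E \<rightarrow>\<^sub>E UNIV \<and>
     (\<forall>(n, m)\<in>E. qpsd (P_mat (x n) (x m) (r (n, m)))))"

definition feasible_B :: "nat set \<Rightarrow> (nat \<times> nat) set \<Rightarrow>
    (nat \<Rightarrow> real^4) \<times> (nat \<times> nat \<Rightarrow> real) \<Rightarrow> bool" where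
  "feasible_B V E = (\<lambda>(x, l). x \<in> V \<rightarrow>\<^sub>E UNIV \<and> l \<in> E \<rightarrow>\<^sub>E UNIV \<and>
     (\<forall>(n, m)\<in>E. psd (Q_mat (x n) (x m) (l (n, m)))))"

definition solves_A :: "nat set \<Rightarrow> (nat \<times> nat) set \<Rightarrow> (nat \<Rightarrow> real) \<Rightarrow> (nat \<times> nat \<Rightarrow> real) \<Rightarrow>
    (nat \<Rightarrow> quat) \<Rightarrow> (nat \<Rightarrow> quat) \<Rightarrow> (nat \<times> nat \<Rightarrow> quat) \<Rightarrow> bool" where
  "solves_A V E w lam y x r \<longleftrightarrow>
     is_arg_min (\<lambda>(x, r). J_obj V E w lam y x r) (feasible_A V E) (x, r)"

definition solves_B :: "nat set \<Rightarrow> (nat \<times> nat) set \<Rightarrow> (nat \<Rightarrow> real) \<Rightarrow> (nat \<times> nat \<Rightarrow> real) \<Rightarrow>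
    (nat \<Rightarrow> real^4) \<Rightarrow> (nat \<Rightarrow> real^4) \<Rightarrow> (nat \<times> nat \<Rightarrow> real) \<Rightarrow> bool" where
  "solves_B V E w lam y x l \<longleftrightarrow>
     is_arg_min (\<lambda>(x, l). K_obj V E w lam y x l) (feasible_B V E) (x, l)"

end

theory Submission
  imports Defs
begin

text \<open>Both problems have the same objective values under the stated maps, so it suffices that
  these maps preserve feasibility. Restricting the Hermitian form of \<open>P\<close> to vectors
  \<open>(a, s, t)\<close> with \<open>a\<close> a quaternion and \<open>s, t\<close> real gives exactly the quadratic form
  of \<open>Q\<close> for \<open>\<ell> = Re r\<close>. Conversely, minimizing the form of \<open>Q\<close> over \<open>a\<close> leaves the
  Schur complement, a real form in \<open>s, t\<close> with off-diagonal entry \<open>\<ell> - \<langle>x\<^sub>n, x\<^sub>m\<rangle>\<close>. The choice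
  of \<open>r\<close> makes the Schur complement of \<open>P\<close> the same real matrix, and a real form applied
  to quaternions splits into its values on the four real components.\<close>

lemma UNIV_6: "UNIV = {1::6, 2, 3, 4, 5, 6}"
proof -
  have "x = 1 \<or> x = 2 \<or> x = 3 \<or> x = 4 \<or> x = 5 \<or> x = 6" for x :: 6
  proof (induct x)
    case (of_int z)
    then have "z = 0 \<or> z = 1 \<or> z = 2 \<or> z = 3 \<or> z = 4 \<or> z = 5" by auto
    then show ?case by auto
  qed
  then show ?thesis by auto
qed

lemma forall_6: "(\<forall>i::6. P i) \<longleftrightarrow> P 1 \<and> P 2 \<and> P 3 \<and> P 4 \<and> P 5 \<and> P 6"
proof -
  have "(\<forall>i::6. P i) \<longleftrightarrow> (\<forall>i\<in>{1, 2, 3, 4, 5, 6}. P i)"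
    unfolding UNIV_6[symmetric] by simp
  then show ?thesis by simp
qed

lemma sum_6: "sum f (UNIV::6 set) = f 1 + f 2 + f 3 + f 4 + f 5 + f 6"
  unfolding UNIV_6 by (simp add: ac_simps)

lemma vector_6 [simp]:
  "(vector [a, b, c, d, e, f] :: 'a::zero^6) $ 1 = a"
  "(vector [a, b, c, d, e, f] :: 'a::zero^6) $ 2 = b"
  "(vector [a, b, c, d, e, f] :: 'a::zero^6) $ 3 = c"
  "(vector [a, b, c, d, e, f] :: 'a::zero^6) $ 4 = d"
  "(vector [a, b, c, d, e, f] :: 'a::zero^6) $ 5 = e"
  "(vector [a, b, c, d, e, f] :: 'a::zero^6) $ 6 = f"
  by (simp_all add: vector_def)

text \<open>The off-diagonal terms come in conjugate pairs, whose sums are twice a real part, and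
  \<open>qRe (qcnj a * q) = inner a q\<close>. Hence the Hermitian form is real.\<close>

lemma qpsd_P_mat_iff:
  "qpsd (P_mat u v r) \<longleftrightarrow>
    (\<forall>a b c. 0 \<le> inner a a + inner b b + inner c c
       + 2 * (inner a (u * b) + inner a (v * c) + inner c (r * b)))"
proof -
  have herm: "hermitian_transpose (P_mat u v r) = P_mat u v r"
    by (simp add: hermitian_transpose_def P_mat_def vec_eq_iff forall_3 quat_eq_iff)
  have form: "(\<Sum>i\<in>UNIV. qcnj (z $ i) * (P_mat u v r *v z) $ i) =
      of_real (inner (z $ 1) (z $ 1) + inner (z $ 2) (z $ 2) + inner (z $ 3) (z $ 3)
       + 2 * (inner (z $ 1) (u * z $ 2) + inner (z $ 1) (v * z $ 3) + inner (z $ 3) (r * z $ 2)))" for z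
    unfolding sum_3 matrix_vector_mult_def P_mat_def quat_eq_iff
      qRe_of_real qI_of_real qJ_of_real qK_of_real
    by (simp add: sum_3 inner_quat_def algebra_simps)
  have nonneg: "of_real t \<in> (\<real>\<^sub>\<ge>\<^sub>0 :: quat set) \<longleftrightarrow> 0 \<le> t" for t :: real
    by (auto simp: nonneg_Reals_def)
  show ?thesis
    unfolding qpsd_def form nonneg
  proof (safe intro!: herm)
    fix a b c :: quat
    assume "\<forall>z::quat^3. 0 \<le> inner (z $ 1) (z $ 1) + inner (z $ 2) (z $ 2) + inner (z $ 3) (z $ 3)
       + 2 * (inner (z $ 1) (u * z $ 2) + inner (z $ 1) (v * z $ 3) + inner (z $ 3) (r * z $ 2))"
    from spec[OF this, of "vector [a, b, c]"]
    show "0 \<le> inner a a + inner b b + inner c c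
       + 2 * (inner a (u * b) + inner a (v * c) + inner c (r * b))" by simp
  qed simp
qed

text \<open>Packing coordinates 1 to 4 of the test vector into a quaternion \<open>a\<close> gives
  the same shape as for \<open>P_mat\<close>, with real \<open>s\<close>, \<open>t\<close> in place
  of \<open>b\<close>, \<open>c\<close>.\<close>

lemma psd_Q_mat_iff:
  "psd (Q_mat (vec_of_quat u) (vec_of_quat v) l) \<longleftrightarrow>
    (\<forall>a s t. 0 \<le> inner a a + s\<^sup>2 + t\<^sup>2 + 2 * (s * inner a u + t * inner a v + s * t * l))"
proof -
  let ?Q = "Q_mat (vec_of_quat u) (vec_of_quat v) l"
  have sym: "transpose ?Q = ?Q"
    by (simp add: transpose_def Q_mat_def vec_eq_iff forall_6)
  have rows:
    "(?Q *v z) $ 1 = z $ 1 + qRe u * z $ 5 + qRe v * z $ 6"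
    "(?Q *v z) $ 2 = z $ 2 + qI u * z $ 5 + qI v * z $ 6"
    "(?Q *v z) $ 3 = z $ 3 + qJ u * z $ 5 + qJ v * z $ 6"
    "(?Q *v z) $ 4 = z $ 4 + qK u * z $ 5 + qK v * z $ 6"
    "(?Q *v z) $ 5 = qRe u * z $ 1 + qI u * z $ 2 + qJ u * z $ 3 + qK u * z $ 4 + z $ 5 + l * z $ 6"
    "(?Q *v z) $ 6 = qRe v * z $ 1 + qI v * z $ 2 + qJ v * z $ 3 + qK v * z $ 4 + l * z $ 5 + z $ 6"
    for z
    by (simp_all add: matrix_vector_mult_def Q_mat_def vec_of_quat_def sum_6)
  have form: "z \<bullet> (?Q *v z) =
      inner a a + (z $ 5)\<^sup>2 + (z $ 6)\<^sup>2
       + 2 * (z $ 5 * inner a u + z $ 6 * inner a v + z $ 5 * z $ 6 * l)"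
    \<comment> \<open>Tying \<open>a\<close> to \<open>z\<close> by an equation serves both
      directions: \<open>a\<close> can be given, or read off from \<open>z\<close>.\<close>
    if "a = Quat (z $ 1) (z $ 2) (z $ 3) (z $ 4)" for z a
    unfolding that inner_vec_def sum_6 rows
    by (simp add: inner_quat_def power2_eq_square algebra_simps)
  show ?thesis
  proof
    assume psd: "psd ?Q"
    show "\<forall>a s t. 0 \<le> inner a a + s\<^sup>2 + t\<^sup>2 + 2 * (s * inner a u + t * inner a v + s * t * l)"
    proof (intro allI)
      fix a s t
      let ?z = "vector [qRe a, qI a, qJ a, qK a, s, t] :: real^6"
      have "0 \<le> ?z \<bullet> (?Q *v ?z)"
        using psd by (simp add: psd_def)
      then show "0 \<le> inner a a + s\<^sup>2 + t\<^sup>2 + 2 * (s * inner a u + t * inner a v + s * t * l)"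
        by (subst (asm) form[of a]) simp_all
    qed
  next
    assume "\<forall>a s t. 0 \<le> inner a a + s\<^sup>2 + t\<^sup>2 + 2 * (s * inner a u + t * inner a v + s * t * l)"
    then show "psd ?Q"
      by (simp add: psd_def sym form[OF refl])
  qed
qed

lemma psd_Q_mat_if_qpsd_P_mat:
  assumes "qpsd (P_mat u v r)"
  shows "psd (Q_mat (vec_of_quat u) (vec_of_quat v) (qRe r))"
  unfolding psd_Q_mat_iff
proof (intro allI)
  fix a :: quat and s t :: real
  \<comment> \<open>For real \<open>s\<close>, \<open>t\<close> the last term is
    \<open>s * t * qRe r\<close>: the imaginary part of \<open>r\<close> drops out.\<close>
  have "0 \<le> inner a a + inner (of_real s :: quat) (of_real s) + inner (of_real t :: quat) (of_real t)
      + 2 * (inner a (u * of_real s) + inner a (v * of_real t) + inner (of_real t) (r * of_real s))"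
    using assms unfolding qpsd_P_mat_iff by blast
  then show "0 \<le> inner a a + s\<^sup>2 + t\<^sup>2 + 2 * (s * inner a u + t * inner a v + s * t * qRe r)"
    by (simp add: inner_quat_def power2_eq_square algebra_simps)
qed

text \<open>Completing the square, \<open>a + u * b + v * c\<close> absorbs every term with
  \<open>a\<close>. Its surplus cross term \<open>inner (v * c) (u * b)\<close> cancels against the
  part \<open>qcnj v * u\<close> contained in the chosen \<open>r\<close>, so only real coefficients
  remain.\<close>

lemma qpsd_P_mat_if_psd_Q_mat:
  assumes "psd (Q_mat (vec_of_quat u) (vec_of_quat v) l)"
  shows "qpsd (P_mat u v (of_real l + qIm (qcnj v * u)))"
  unfolding qpsd_P_mat_iff
proof (intro allI)
  fix a b c :: quat
  \<comment> \<open>The form of the Schur complement of the identity block in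
    \<open>Q_mat\<close>.\<close>
  define d where "d s t = (1 - inner u u) * s\<^sup>2 + (1 - inner v v) * t\<^sup>2
    + 2 * (s * t * (l - inner u v))" for s t
  have d_nonneg: "0 \<le> d s t" for s t
  proof -
    \<comment> \<open>the value of \<open>a\<close> that minimizes the form of \<open>Q\<close>\<close>
    have "0 \<le> inner p p + s\<^sup>2 + t\<^sup>2 + 2 * (s * inner p u + t * inner p v + s * t * l)"
      if "p = - (s *\<^sub>R u + t *\<^sub>R v)" for p
      using assms unfolding psd_Q_mat_iff by blast
    from this[OF refl] show ?thesis
      by (simp add: d_def inner_add_left inner_add_right inner_commute[of v u]
          power2_eq_square algebra_simps)
  qed
  let ?e = "a + u * b + v * c"
  \<comment> \<open>The quaternion norm is multiplicative, so the squares of \<open>u * b\<close>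
    and \<open>v * c\<close> only rescale those of \<open>b\<close> and \<open>c\<close>.\<close>
  have mult: "inner (p * q) (p * q) = inner p p * inner q q" for p q :: quat
    by (simp add: inner_quat_def algebra_simps)
  \<comment> \<open>Left multiplication by \<open>v\<close> has left multiplication by
    \<open>qcnj v\<close> as its adjoint.\<close>
  have adj: "inner (v * c) (u * b) = inner c ((qcnj v * u) * b)"
    by (simp add: inner_quat_def algebra_simps)
  \<comment> \<open>The real part of \<open>qcnj v * u\<close> is \<open>inner u v\<close>;
    exchanging it for \<open>l\<close> costs a real multiple of 1.\<close>
  have r_eq: "of_real l + qIm (qcnj v * u) = (l - inner u v) *\<^sub>R 1 + qcnj v * u"
    by (simp add: quat_eq_iff qIm_def inner_quat_def)
  have comp: "d (qRe b) (qRe c) + d (qI b) (qI c) + d (qJ b) (qJ c) + d (qK b) (qK c)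
      = (1 - inner u u) * inner b b + (1 - inner v v) * inner c c + 2 * ((l - inner u v) * inner c b)"
    unfolding d_def inner_quat_def[of b] inner_quat_def[of c] by (simp add: power2_eq_square algebra_simps)
  have "inner a a + inner b b + inner c c + 2 * (inner a (u * b) + inner a (v * c)
      + inner c ((of_real l + qIm (qcnj v * u)) * b))
    = inner ?e ?e + (d (qRe b) (qRe c) + d (qI b) (qI c) + d (qJ b) (qJ c) + d (qK b) (qK c))"
  proof -
    have "inner ?e ?e = inner a a + inner (u * b) (u * b) + inner (v * c) (v * c)
        + 2 * (inner a (u * b) + inner a (v * c) + inner (v * c) (u * b))"
      by (simp add: inner_add_left inner_add_right inner_commute)
    then show ?thesis
      unfolding comp r_eq mult adj by (simp add: algebra_simps)
  qed
  also have "\<dots> \<ge> 0"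
    by (intro add_nonneg_nonneg d_nonneg inner_ge_zero)
  finally show "0 \<le> inner a a + inner b b + inner c c + 2 * (inner a (u * b) + inner a (v * c)
      + inner c ((of_real l + qIm (qcnj v * u)) * b))" .
qed

lemma inner_vec_of_quat: "vec_of_quat u \<bullet> vec_of_quat v = qRe (u * qcnj v)"
  by (simp add: inner_vec_def sum_4 vec_of_quat_def)

text \<open>Asking for agreement only on \<open>V\<close> and \<open>E\<close> lets one lemma treat
  the maps between the problems in both directions.\<close>

lemma K_obj_eq_J_obj:
  assumes "\<And>n. n \<in> V \<Longrightarrow> x' n = vec_of_quat (x n)" "\<And>e. e \<in> E \<Longrightarrow> l e = qRe (r e)"
  shows "K_obj V E w lam (\<lambda>n. vec_of_quat (y n)) x' l = J_obj V E w lam y x r"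
  unfolding K_obj_def J_obj_def using assms by (simp add: inner_vec_of_quat)

text \<open>Both endpoints of an edge lie in \<open>V\<close>, where the restricted families keep
  their values instead of \<open>undefined\<close>.\<close>

lemma feasible_B_if_feasible_A:
  assumes "E \<subseteq> V \<times> V" "feasible_A V E (x, r)"
  shows "feasible_B V E (\<lambda>n\<in>V. vec_of_quat (x n), \<lambda>e\<in>E. qRe (r e))"
  using assms by (auto simp: feasible_A_def feasible_B_def intro!: psd_Q_mat_if_qpsd_P_mat)

lemma feasible_A_if_feasible_B:
  assumes "E \<subseteq> V \<times> V" "feasible_B V E (x, l)"
  shows "feasible_A V E (\<lambda>n\<in>V. quat_of_vec (x n),
    \<lambda>(n, m)\<in>E. of_real (l (n, m)) + qIm (qcnj (quat_of_vec (x m)) * quat_of_vec (x n)))"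
  using assms by (fastforce simp: feasible_A_def feasible_B_def intro!: qpsd_P_mat_if_psd_Q_mat)

theorem theorem9:
  fixes N :: nat and V :: "nat set" and E :: "(nat \<times> nat) set"
    and w :: "nat \<Rightarrow> real" and lam :: "nat \<times> nat \<Rightarrow> real" and y :: "nat \<Rightarrow> quat"
  assumes "V = {1..N}"
    and "E \<subseteq> {(n, m) \<in> V \<times> V. n < m}"
    and "connected_graph V E"
    and "\<forall>n\<in>V. w n > 0"
    and "\<forall>e\<in>E. lam e > 0"
    and "\<forall>n\<in>V. norm (y n) = 1"
  shows "(\<forall>x r. solves_A V E w lam y x r \<longrightarrow>
            solves_B V E w lam (\<lambda>n. vec_of_quat (y n))
              (\<lambda>n\<in>V. vec_of_quat (x n)) (\<lambda>e\<in>E. qRe (r e))) \<and>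
         (\<forall>x l. solves_B V E w lam (\<lambda>n. vec_of_quat (y n)) x l \<longrightarrow>
            solves_A V E w lam y
              (\<lambda>n\<in>V. quat_of_vec (x n))
              (\<lambda>(n, m)\<in>E. of_real (l (n, m)) + qIm (qcnj (quat_of_vec (x m)) * quat_of_vec (x n))))"
proof -
  have E: "E \<subseteq> V \<times> V"
    using assms(2) by auto
  let ?J = "J_obj V E w lam y" and ?K = "K_obj V E w lam (\<lambda>n. vec_of_quat (y n))"
  let ?x' = "\<lambda>x. \<lambda>n\<in>V. vec_of_quat (x n)" and ?l' = "\<lambda>r. \<lambda>e\<in>E. qRe (r e)"
  let ?x'' = "\<lambda>x. \<lambda>n\<in>V. quat_of_vec (x n)"
  let ?r'' = "\<lambda>x l. \<lambda>(n, m)\<in>E. of_real (l (n, m)) + qIm (qcnj (quat_of_vec (x m)) * quat_of_vec (x n))"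
  have down: "?K (?x' x) (?l' r) = ?J x r" for x r
    by (rule K_obj_eq_J_obj) simp_all
  \<comment> \<open>\<open>qIm\<close> has real part 0, so the real part of the new \<open>r\<close>
    is \<open>l\<close>.\<close>
  have up: "?J (?x'' x) (?r'' x l) = ?K x l" for x l
    by (rule K_obj_eq_J_obj[symmetric]) (auto simp: qIm_def)
  have A: "solves_A V E w lam y x r \<longleftrightarrow>
      feasible_A V E (x, r) \<and> (\<forall>x' r'. feasible_A V E (x', r') \<longrightarrow> ?J x r \<le> ?J x' r')" for x r
    by (auto simp: solves_A_def is_arg_min_linorder)
  have B: "solves_B V E w lam (\<lambda>n. vec_of_quat (y n)) x l \<longleftrightarrow>
      feasible_B V E (x, l) \<and> (\<forall>x' l'. feasible_B V E (x', l') \<longrightarrow> ?K x l \<le> ?K x' l')" for x l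
    by (auto simp: solves_B_def is_arg_min_linorder)
  show ?thesis
    unfolding A B down up
  proof (intro conjI allI impI; elim conjE)
    fix x r x' l'
    assume "feasible_A V E (x, r)"
      and min: "\<forall>x' r'. feasible_A V E (x', r') \<longrightarrow> ?J x r \<le> ?J x' r'"
    then show "feasible_B V E (?x' x, ?l' r)"
      by (intro feasible_B_if_feasible_A[OF E])
    assume "feasible_B V E (x', l')"
    \<comment> \<open>The competitor moves to the other problem at equal cost and is compared there;
      only its value has to survive.\<close>
    then have "?J x r \<le> ?J (?x'' x') (?r'' x' l')"
      using min feasible_A_if_feasible_B[OF E] by blast
    then show "?J x r \<le> ?K x' l'"
      unfolding up .
  next
    fix x l x' r'
    assume "feasible_B V E (x, l)"
      and min: "\<forall>x' l'. feasible_B V E (x', l') \<longrightarrow> ?K x l \<le> ?K x' l'"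
    then show "feasible_A V E (?x'' x, ?r'' x l)"
      by (intro feasible_A_if_feasible_B[OF E])
    assume "feasible_A V E (x', r')"
    then have "?K x l \<le> ?K (?x' x') (?l' r')"
      using min feasible_B_if_feasible_A[OF E] by blast
    then show "?K x l \<le> ?J x' r'"
      unfolding down .
  qed
qed

end
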